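(* For any fixed integers $3\leq c\leq d$, there is no $k\in\mathbb{N}$ such that $\mathrm{BA}^k$ solves $\mathrm{PCSP}(\mathbf{K}_c,\mathbf{K}_d)$.
   Context: Digraphs are finite: a digraph $\mathbf{X}$ has a vertex set $V(\mathbf{X})$ and an edge set $E(\mathbf{X})\subseteq V(\mathbf{X})^2$. A homomorphism $\mathbf{X}\to\mathbf{A}$ is a map $f:V(\mathbf{X})\to V(\mathbf{A})$ with $(f(u),f(v))\in E(\mathbf{A})$ for all $(u,v)\in E(\mathbf{X})$; we write $\mathbf{X}\to\mathbf{A}$ if one exists. $\mathbf{K}_p$ is the digraph with vertex set $[p]=\{1,\dots,p\}$ and all pairs of distinct vertices as edges. For a tuple $\mathbf{z}=(z_1,\dots,z_m)$ and $\mathbf{i}=(i_1,\dots,i_p)\in[m]^p$, write $\mathbf{z}_{\mathbf{i}}=(z_{i_1},\dots,z_{i_p})$. For tuples $\mathbf{s},\mathbf{t}$ of the same length $k$, write $\mathbf{s}\prec\mathbf{t}$ if for all $i,j\in[k]$, $s_i=s_j$ implies $t_i=t_j$, and $\mathbf{s}\not\prec\mathbf{t}$ for its negation. For digraphs $\mathbf{X},\mathbf{A}$ and $k\in\mathbb{N}$, take variables $\lambda_{\mathbf{x},\mathbf{a}}$ ($\mathbf{x}\in V(\mathbf{X})^k$, $\mathbf{a}\in V(\mathbf{A})^k$) and $\mu_{\mathbf{y},\mathbf{b}}$ ($\mathbf{y}\in E(\mathbf{X})$, $\mathbf{b}\in E(\mathbf{A})$) and the equations: (1) $\sum_{\mathbf{a}\in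 V(\mathbf{A})^k}\lambda_{\mathbf{x},\mathbf{a}}=1$ for all $\mathbf{x}\in V(\mathbf{X})^k$; (2) $\sum_{\hat{\mathbf{a}}\in V(\mathbf{A})^k,\ \hat{\mathbf{a}}_{\mathbf{i}}=\mathbf{a}}\lambda_{\mathbf{x},\hat{\mathbf{a}}}=\lambda_{\mathbf{x}_{\mathbf{i}},\mathbf{a}}$ for all $\mathbf{x}\in V(\mathbf{X})^k$, $\mathbf{i}\in[k]^k$, $\mathbf{a}\in V(\mathbf{A})^k$; (3) $\sum_{\mathbf{b}\in E(\mathbf{A}),\ \mathbf{b}_{\mathbf{i}}=\mathbf{a}}\mu_{\mathbf{y},\mathbf{b}}=\lambda_{\mathbf{y}_{\mathbf{i}},\mathbf{a}}$ for all $\mathbf{y}\in E(\mathbf{X})$, $\mathbf{i}\in[2]^k$, $\mathbf{a}\in V(\mathbf{A})^k$; (4) $\lambda_{\mathbf{x},\mathbf{a}}=0$ whenever $\mathbf{x}\not\prec\mathbf{a}$; (5) $\mu_{\mathbf{y},\mathbf{b}}=0$ whenever $\mathbf{y}\not\prec\mathbf{b}$. For $k\geq 2$, $\mathrm{BA}^k(\mathbf{X},\mathbf{A})=\textsc{Yes}$ means that equations (1)–(5) have a solution $(\lambda^{(B)},\mu^{(B)})$ in nonnegative rationals and a solution $(\lambda^{(A)},\mu^{(A)})$ in integers such that $\lambda^{(B)}_{\mathbf{x},\mathbf{a}}=0\Rightarrow\lambda^{(A)}_{\mathbf{x},\mathbf{a}}=0$ and $\mu^{(B)}_{\mathbf{y},\mathbf{b}}=0\Rightarrow\mu^{(A)}_{\mathbf{y},\mathbf{b}}=0$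 for all indices. For $k=1$, $\mathrm{BA}^1(\mathbf{X},\mathbf{A})=\textsc{Yes}$ is defined identically except that only equations (1)–(4) are imposed. Given digraphs with $\mathbf{A}\to\mathbf{B}$, $\mathrm{PCSP}(\mathbf{A},\mathbf{B})$ is the problem of answering Yes if the input $\mathbf{X}$ satisfies $\mathbf{X}\to\mathbf{A}$ and No if $\mathbf{X}\not\to\mathbf{B}$; $\mathrm{BA}^k$ solves $\mathrm{PCSP}(\mathbf{A},\mathbf{B})$ if for every finite digraph $\mathbf{X}$, $\mathrm{BA}^k(\mathbf{X},\mathbf{A})=\textsc{Yes}$ implies $\mathbf{X}\to\mathbf{B}$. *)

theory Defs
  imports "HOL-Library.NList" "Graph_Theory.Pair_Digraph"
begin

text \<open>
  A finite digraph is a \<open>pair_fin_digraph\<close>: the edge set is a subset of the square of the finite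
  vertex set, and loops are allowed.
\<close>

definition digraph_hom :: "'v pair_pre_digraph \<Rightarrow> 'a pair_pre_digraph \<Rightarrow> ('v \<Rightarrow> 'a) \<Rightarrow> bool" where
  "digraph_hom X A f \<longleftrightarrow>
     (\<forall>v\<in>pverts X. f v \<in> pverts A) \<and> (\<forall>(u, v)\<in>parcs X. (f u, f v) \<in> parcs A)"

definition hom_exists :: "'v pair_pre_digraph \<Rightarrow> 'a pair_pre_digraph \<Rightarrow> bool" where
  "hom_exists X A \<longleftrightarrow> (\<exists>f. digraph_hom X A f)"

definition complete_digraph_on :: "nat \<Rightarrow> nat pair_pre_digraph" where
  "complete_digraph_on p =
     \<lparr>pverts = {1..p}, parcs = {(u, v). u \<in> {1..p} \<and> v \<in> {1..p} \<and> u \<noteq> v}\<rparr>"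

text \<open>
  Tuples in \<open>V\<^sup>k\<close> are lists in \<open>nlists k V\<close>. Positions are counted from 0, so an index tuple
  in \<open>[m]\<^sup>p\<close> is a list in \<open>nlists p {..<m}\<close>.
\<close>

definition proj :: "'v list \<Rightarrow> nat list \<Rightarrow> 'v list" where
  "proj z i = map (\<lambda>j. z ! j) i"

definition tuple_prec :: "'v list \<Rightarrow> 'a list \<Rightarrow> bool" (infix "\<prec>\<^sub>t" 50) where
  "s \<prec>\<^sub>t t \<longleftrightarrow> (\<forall>i<length s. \<forall>j<length s. s ! i = s ! j \<longrightarrow> t ! i = t ! j)"

definition edge_tuple :: "'v \<times> 'v \<Rightarrow> 'v list" where
  "edge_tuple e = [fst e, snd e]"

text \<open>
  The equations have integer coefficients; \<open>'r\<close> is instantiated to the rationals and to the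
  integers. The functions \<open>lam\<close> and \<open>mu\<close> are total, but only their values at the index pairs
  of the system are constrained.
\<close>

definition eq_sum_one ::
  "nat \<Rightarrow> 'v pair_pre_digraph \<Rightarrow> 'a pair_pre_digraph \<Rightarrow> ('v list \<Rightarrow> 'a list \<Rightarrow> 'r::comm_ring_1) \<Rightarrow> bool"
where
  "eq_sum_one k X A lam \<longleftrightarrow>
     (\<forall>x\<in>nlists k (pverts X). (\<Sum>a\<in>nlists k (pverts A). lam x a) = 1)"

definition eq_vertex_marginals ::
  "nat \<Rightarrow> 'v pair_pre_digraph \<Rightarrow> 'a pair_pre_digraph \<Rightarrow> ('v list \<Rightarrow> 'a list \<Rightarrow> 'r::comm_ring_1) \<Rightarrow> bool"
where
  "eq_vertex_marginals k X A lam \<longleftrightarrow>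
     (\<forall>x\<in>nlists k (pverts X). \<forall>i\<in>nlists k {..<k}. \<forall>a\<in>nlists k (pverts A).
        (\<Sum>a'\<in>{a'\<in>nlists k (pverts A). proj a' i = a}. lam x a') = lam (proj x i) a)"

definition eq_edge_marginals ::
  "nat \<Rightarrow> 'v pair_pre_digraph \<Rightarrow> 'a pair_pre_digraph \<Rightarrow>
   ('v list \<Rightarrow> 'a list \<Rightarrow> 'r::comm_ring_1) \<Rightarrow> ('v \<times> 'v \<Rightarrow> 'a \<times> 'a \<Rightarrow> 'r) \<Rightarrow> bool"
where
  "eq_edge_marginals k X A lam mu \<longleftrightarrow>
     (\<forall>y\<in>parcs X. \<forall>i\<in>nlists k {..<2}. \<forall>a\<in>nlists k (pverts A).
        (\<Sum>b\<in>{b\<in>parcs A. proj (edge_tuple b) i = a}. mu y b) = lam (proj (edge_tuple y) i) a)"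

definition eq_vertex_prec ::
  "nat \<Rightarrow> 'v pair_pre_digraph \<Rightarrow> 'a pair_pre_digraph \<Rightarrow> ('v list \<Rightarrow> 'a list \<Rightarrow> 'r::comm_ring_1) \<Rightarrow> bool"
where
  "eq_vertex_prec k X A lam \<longleftrightarrow>
     (\<forall>x\<in>nlists k (pverts X). \<forall>a\<in>nlists k (pverts A). \<not> x \<prec>\<^sub>t a \<longrightarrow> lam x a = 0)"

definition eq_edge_prec ::
  "'v pair_pre_digraph \<Rightarrow> 'a pair_pre_digraph \<Rightarrow> ('v \<times> 'v \<Rightarrow> 'a \<times> 'a \<Rightarrow> 'r::comm_ring_1) \<Rightarrow> bool"
where
  "eq_edge_prec X A mu \<longleftrightarrow>
     (\<forall>y\<in>parcs X. \<forall>b\<in>parcs A. \<not> edge_tuple y \<prec>\<^sub>t edge_tuple b \<longrightarrow> mu y b = 0)"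

text \<open>The last equation is imposed at levels \<open>k \<ge> 2\<close> only.\<close>

definition BA_system ::
  "nat \<Rightarrow> 'v pair_pre_digraph \<Rightarrow> 'a pair_pre_digraph \<Rightarrow>
   ('v list \<Rightarrow> 'a list \<Rightarrow> 'r::comm_ring_1) \<Rightarrow> ('v \<times> 'v \<Rightarrow> 'a \<times> 'a \<Rightarrow> 'r) \<Rightarrow> bool"
where
  "BA_system k X A lam mu \<longleftrightarrow>
     eq_sum_one k X A lam \<and>
     eq_vertex_marginals k X A lam \<and>
     eq_edge_marginals k X A lam mu \<and>
     eq_vertex_prec k X A lam \<and>
     (k \<ge> 2 \<longrightarrow> eq_edge_prec X A mu)"

definition BA :: "nat \<Rightarrow> 'v pair_pre_digraph \<Rightarrow> 'a pair_pre_digraph \<Rightarrow> bool" where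
  "BA k X A \<longleftrightarrow>
     (\<exists>(lamB :: 'v list \<Rightarrow> 'a list \<Rightarrow> rat) (muB :: 'v \<times> 'v \<Rightarrow> 'a \<times> 'a \<Rightarrow> rat)
       (lamA :: 'v list \<Rightarrow> 'a list \<Rightarrow> int) (muA :: 'v \<times> 'v \<Rightarrow> 'a \<times> 'a \<Rightarrow> int).
        BA_system k X A lamB muB \<and>
        (\<forall>x\<in>nlists k (pverts X). \<forall>a\<in>nlists k (pverts A). 0 \<le> lamB x a) \<and>
        (\<forall>y\<in>parcs X. \<forall>b\<in>parcs A. 0 \<le> muB y b) \<and>
        BA_system k X A lamA muA \<and>
        (\<forall>x\<in>nlists k (pverts X). \<forall>a\<in>nlists k (pverts A). lamB x a = 0 \<longrightarrow> lamA x a = 0) \<and>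
        (\<forall>y\<in>parcs X. \<forall>b\<in>parcs A. muB y b = 0 \<longrightarrow> muA y b = 0))"

text \<open>
  Instances have natural numbers as vertices. This is no loss of generality: every finite digraph
  is isomorphic to one of these, and \<open>BA\<close> and the existence of homomorphisms are invariant
  under isomorphism.
\<close>

definition BA_solves_PCSP :: "nat \<Rightarrow> 'a pair_pre_digraph \<Rightarrow> 'b pair_pre_digraph \<Rightarrow> bool" where
  "BA_solves_PCSP k A B \<longleftrightarrow>
     (\<forall>X :: nat pair_pre_digraph. pair_fin_digraph X \<longrightarrow> BA k X A \<longrightarrow> hom_exists X B)"

end

(*
  A random map G from [n] to a set L of letters that is injective on every set of at most K points,
  given only through consistent marginals on such sets, turns every 3-colouring h of the shift
  digraph on r-tuples over L into a solution of the level-k system for the shift digraph on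
  r-subsets of [n], provided 2kr <= K: give the vertex x the colour h(G(x)). Rational marginals are
  those of uniform injections. Integral marginals exist for a suitable L with K^2 letters, and their
  support automatically lies in that of the uniform ones. Since the largest number of letters for
  which the shift digraph is 3-colourable grows as a tower in r, it exceeds (2kr)^2 for some r; but
  by Ramsey's theorem the shift digraph on r-subsets of [n] is not d-colourable for large n.
*)
theory Submission
  imports Defs "HOL-Library.Ramsey" "HOL-Library.Nat_Bijection" "HOL-Library.FuncSet"
begin

declare nlistsE_length [simp del] nlistsE_set [simp del]

section \<open>Consistent local marginals and their expectations\<close>

text \<open>\<open>W S\<close> plays the law of a random map restricted to \<open>S\<close>.
  Consistency is asked only up to \<open>K\<close> points, so no global law need exist. The values
  lie in any commutative ring, so that rational and signed integral weights are treated
  alike.\<close>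

locale local_measures =
  fixes L :: "'l set" and K :: nat and W :: "'s set \<Rightarrow> ('s \<Rightarrow> 'l) \<Rightarrow> 'r::comm_ring_1"
  assumes finite_L: "finite L"
    and W_empty: "W {} G = 1"
    and W_marginal: "\<lbrakk>finite S; card S \<le> K; i \<in> S\<rbrakk> \<Longrightarrow> (\<Sum>v\<in>L. W S (G(i := v))) = W (S - {i}) G"
    and W_inj: "\<lbrakk>finite S; W S G \<noteq> 0\<rbrakk> \<Longrightarrow> inj_on G S"
begin

definition expect :: "'s set \<Rightarrow> (('s \<Rightarrow> 'l) \<Rightarrow> 'r) \<Rightarrow> 'r" where
  "expect S F = (\<Sum>G\<in>S \<rightarrow>\<^sub>E L. W S G * F G)"

lemma expect_cong:
  assumes "finite S" "\<And>G. \<lbrakk>G \<in> S \<rightarrow>\<^sub>E L; inj_on G S\<rbrakk> \<Longrightarrow> F G = F' G"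
  shows "expect S F = expect S F'"
  unfolding expect_def
proof (rule sum.cong)
  fix G assume "G \<in> S \<rightarrow>\<^sub>E L"
  then show "W S G * F G = W S G * F' G"
    using assms W_inj[of S G] by (cases "W S G = 0") auto
qed simp

text \<open>A Fubini argument: a map on \<open>S\<close> is a value at \<open>i\<close> together
  with a map on the rest. Since \<open>F\<close> ignores the value at \<open>i\<close>, the inner
  sum is the one in \<open>W_marginal\<close>.\<close>

lemma expect_remove:
  assumes "finite S" "card S \<le> K" "i \<in> S" and F: "\<And>G v. F (G(i := v)) = F G"
  shows "expect S F = expect (S - {i}) F"
proof -
  let ?T = "S - {i}"
  have fin: "finite (?T \<rightarrow>\<^sub>E L)" using assms finite_L by (auto intro!: finite_PiE)
  have "S \<rightarrow>\<^sub>E L = (\<lambda>(v, G). G(i := v)) ` (L \<times> (?T \<rightarrow>\<^sub>E L))"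
    using PiE_insert_eq[of i ?T "\<lambda>_. L"] assms(3) by (simp add: insert_absorb)
  then have "expect S F = (\<Sum>(v, G)\<in>L \<times> (?T \<rightarrow>\<^sub>E L). W S (G(i := v)) * F (G(i := v)))"
    unfolding expect_def using sum.reindex[OF inj_combinator[of i ?T "\<lambda>_. L"]]
    by (simp add: case_prod_unfold)
  also have "\<dots> = (\<Sum>G\<in>?T \<rightarrow>\<^sub>E L. \<Sum>v\<in>L. W S (G(i := v)) * F G)"
    by (subst sum.swap) (simp add: sum.cartesian_product F)
  also have "\<dots> = (\<Sum>G\<in>?T \<rightarrow>\<^sub>E L. W ?T G * F G)"
    using assms by (simp add: W_marginal flip: sum_distrib_right)
  finally show ?thesis by (simp add: expect_def)
qed

text \<open>Points outside \<open>T\<close> are summed out one at a time; the sets only shrink, so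
  the bound \<open>K\<close> persists. Both marginal equations rest on this.\<close>

lemma expect_mono_scope:
  assumes "finite S" "card S \<le> K" "T \<subseteq> S"
    and F: "\<And>G G'. (\<And>i. i \<in> T \<Longrightarrow> G i = G' i) \<Longrightarrow> F G = F G'"
  shows "expect S F = expect T F"
  using assms(1-3)
proof (induction "card S" arbitrary: S rule: less_induct)
  case less
  show ?case
  proof (cases "S = T")
    case False
    then obtain i where i: "i \<in> S" "i \<notin> T" using less.prems by blast
    have "expect S F = expect (S - {i}) F"
      using less.prems i by (intro expect_remove F) auto
    also have "\<dots> = expect T F"
      using less.prems i card_Diff1_less[of S i] by (intro less.hyps) auto
    finally show ?thesis .
  qed simp
qed

lemma expect_one:
  assumes "finite S" "card S \<le> K"
  shows "expect S (\<lambda>_. 1) = 1"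
  by (subst expect_mono_scope[of _ "{}"]) (use assms in \<open>auto simp: expect_def W_empty\<close>)

lemma sum_expect_indicator:
  assumes "finite Q"
  shows "(\<Sum>a\<in>Q. expect S (\<lambda>G. of_bool (f G = a))) = expect S (\<lambda>G. of_bool (f G \<in> Q))"
proof -
  have "(\<Sum>a\<in>Q. of_bool (f G = a)) = (of_bool (f G \<in> Q) :: 'r)" for G
    using assms by (simp add: of_bool_def)
  then show ?thesis
    unfolding expect_def by (subst sum.swap) (simp flip: sum_distrib_left)
qed

end

section \<open>From random local colourings to solutions of the system\<close>

lemma nlists_finite: "finite V \<Longrightarrow> finite (nlists k V)"
  unfolding nlists_def using finite_lists_length_eq[of V k] by (metis (no_types, lifting) Collect_cong)

text \<open>\<open>scope v\<close> holds the points that the colour of \<open>v\<close> reads. The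
  factor \<open>2 * k\<close> leaves room for the scopes of a \<open>k\<close>-tuple and, already at
  \<open>k = 1\<close>, for both ends of an arc.\<close>

locale local_colouring =
  fixes L :: "'l set" and K :: nat and k :: nat
    and X :: "'v pair_pre_digraph" and A :: "'a pair_pre_digraph"
    and scope :: "'v \<Rightarrow> 's set" and col :: "('s \<Rightarrow> 'l) \<Rightarrow> 'v \<Rightarrow> 'a"
  assumes k_pos: "k \<ge> 1"
    and wf_X: "pair_wf_digraph X"
    and fin_A: "pair_fin_digraph A"
    and finite_scope: "v \<in> pverts X \<Longrightarrow> finite (scope v)"
    and card_scope: "v \<in> pverts X \<Longrightarrow> 2 * k * card (scope v) \<le> K"
    and col_local: "(\<And>i. i \<in> scope v \<Longrightarrow> G i = G' i) \<Longrightarrow> col G v = col G' v"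
    and col_vert: "\<lbrakk>v \<in> pverts X; G ` scope v \<subseteq> L; inj_on G (scope v)\<rbrakk> \<Longrightarrow> col G v \<in> pverts A"
    and col_arc: "\<lbrakk>(u, v) \<in> parcs X; G ` (scope u \<union> scope v) \<subseteq> L; inj_on G (scope u \<union> scope v)\<rbrakk>
      \<Longrightarrow> (col G u, col G v) \<in> parcs A"
begin

abbreviation scopes :: "'v list \<Rightarrow> 's set" where
  "scopes x \<equiv> \<Union>v\<in>set x. scope v"

lemma finite_scopes: "set x \<subseteq> pverts X \<Longrightarrow> finite (scopes x)"
  using finite_scope by auto

lemma card_scopes:
  assumes "set x \<subseteq> pverts X" "length x \<le> 2 * k"
  shows "card (scopes x) \<le> K"
proof (cases "x = []")
  case False
  define M where "M = Max ((\<lambda>v. card (scope v)) ` set x)"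
  have M: "card (scope v) \<le> M" if "v \<in> set x" for v
    unfolding M_def using that by simp
  have "M \<in> (\<lambda>v. card (scope v)) ` set x"
    unfolding M_def by (rule Max_in) (use False in auto)
  then have MK: "2 * k * M \<le> K" using card_scope assms by auto
  have "card (scopes x) \<le> (\<Sum>v\<in>set x. card (scope v))"
    by (rule card_UN_le) simp
  also have "\<dots> \<le> card (set x) * M"
    using sum_bounded_above[of "set x" "\<lambda>v. card (scope v)" M] M by simp
  also have "\<dots> \<le> 2 * k * M"
    using card_length[of x] assms(2) by (intro mult_right_mono) auto
  finally show ?thesis using MK by simp
qed simp

lemma map_col_local:
  assumes "\<And>i. i \<in> scopes x \<Longrightarrow> G i = G' i"
  shows "map (col G) x = map (col G') x"
  using assms by (auto intro!: col_local)

lemma map_col_nlists: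
  assumes "x \<in> nlists m (pverts X)" "G \<in> scopes x \<rightarrow>\<^sub>E L" "inj_on G (scopes x)"
  shows "map (col G) x \<in> nlists m (pverts A)"
proof -
  have "col G v \<in> pverts A" if "v \<in> set x" for v
  proof (rule col_vert)
    show "v \<in> pverts X" using that assms(1) by (auto simp: nlists_def)
    show "G ` scope v \<subseteq> L" using that assms(2) by auto
    show "inj_on G (scope v)" by (rule inj_on_subset[OF assms(3)]) (use that in auto)
  qed
  then show ?thesis using assms(1) by (auto simp: nlists_def)
qed

end

lemma proj_map: "set i \<subseteq> {..<length x} \<Longrightarrow> proj (map f x) i = map f (proj x i)"
  by (auto simp: proj_def)

lemma set_proj: "set i \<subseteq> {..<length x} \<Longrightarrow> set (proj x i) \<subseteq> set x"
  by (auto simp: proj_def)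

locale local_solution =
  local_colouring L K k X A scope col + local_measures L K W
  for L :: "'l set" and K k :: nat and X :: "'v pair_pre_digraph" and A :: "'a pair_pre_digraph"
    and scope :: "'v \<Rightarrow> 's set" and col :: "('s \<Rightarrow> 'l) \<Rightarrow> 'v \<Rightarrow> 'a"
    and W :: "'s set \<Rightarrow> ('s \<Rightarrow> 'l) \<Rightarrow> 'r::comm_ring_1"
begin

text \<open>The signed probability that the random colouring sends \<open>x\<close> to
  \<open>a\<close>.\<close>

definition lam :: "'v list \<Rightarrow> 'a list \<Rightarrow> 'r" where
  "lam x a = expect (scopes x) (\<lambda>G. of_bool (map (col G) x = a))"

definition mu :: "'v \<times> 'v \<Rightarrow> 'a \<times> 'a \<Rightarrow> 'r" where
  "mu y b = expect (scope (fst y) \<union> scope (snd y)) (\<lambda>G. of_bool ((col G (fst y), col G (snd y)) = b))"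

lemma eq_sum_one_lam: "eq_sum_one k X A lam"
  unfolding eq_sum_one_def
proof
  fix x assume x: "x \<in> nlists k (pverts X)"
  then have xs: "set x \<subseteq> pverts X" "length x = k" by (auto simp: nlists_def)
  have fin: "finite (nlists k (pverts A))"
    using fin_A by (simp add: nlists_finite pair_fin_digraph.pair_finite_verts)
  have "(\<Sum>a\<in>nlists k (pverts A). lam x a) = expect (scopes x) (\<lambda>G. of_bool (map (col G) x \<in> nlists k (pverts A)))"
    unfolding lam_def by (rule sum_expect_indicator[OF fin])
  also have "\<dots> = expect (scopes x) (\<lambda>_. 1)"
    using finite_scopes[OF xs(1)] by (rule expect_cong) (simp add: map_col_nlists[OF x])
  also have "\<dots> = 1"
    using xs by (intro expect_one finite_scopes[OF xs(1)] card_scopes) auto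
  finally show "(\<Sum>a\<in>nlists k (pverts A). lam x a) = 1" .
qed

text \<open>The sum adds up disjoint events; their union reads only the scopes of
  \<open>proj x i\<close>, so the other points can be forgotten.\<close>

lemma eq_vertex_marginals_lam: "eq_vertex_marginals k X A lam"
  unfolding eq_vertex_marginals_def
proof (intro ballI)
  fix x :: "'v list" and i :: "nat list" and a :: "'a list"
  assume x: "x \<in> nlists k (pverts X)" and i: "i \<in> nlists k {..<k}" and a: "a \<in> nlists k (pverts A)"
  let ?Q = "{a' \<in> nlists k (pverts A). proj a' i = a}"
  have xs: "set x \<subseteq> pverts X" "length x = k" and isub: "set i \<subseteq> {..<length x}"
    using x i by (auto simp: nlists_def)
  have fin: "finite ?Q"
    using fin_A by (simp add: nlists_finite pair_fin_digraph.pair_finite_verts)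
  have "(\<Sum>a'\<in>?Q. lam x a') = expect (scopes x) (\<lambda>G. of_bool (map (col G) x \<in> ?Q))"
    unfolding lam_def by (rule sum_expect_indicator[OF fin])
  also have "\<dots> = expect (scopes x) (\<lambda>G. of_bool (map (col G) (proj x i) = a))"
    using finite_scopes[OF xs(1)]
    by (rule expect_cong) (simp add: map_col_nlists[OF x] proj_map[OF isub])
  also have "\<dots> = expect (scopes (proj x i)) (\<lambda>G. of_bool (map (col G) (proj x i) = a))"
  proof (rule expect_mono_scope)
    show "finite (scopes x)" by (rule finite_scopes[OF xs(1)])
    show "card (scopes x) \<le> K" using xs by (intro card_scopes) auto
    show "scopes (proj x i) \<subseteq> scopes x" using set_proj[OF isub] by auto
  qed (use map_col_local in metis)
  finally show "(\<Sum>a'\<in>?Q. lam x a') = lam (proj x i) a" by (simp add: lam_def)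
qed

text \<open>By \<open>col_arc\<close> the colours of \<open>y\<close> form an arc of
  \<open>A\<close> under every injective map, so summing over arcs of \<open>A\<close> loses no
  mass.\<close>

lemma eq_edge_marginals_lam: "eq_edge_marginals k X A lam mu"
  unfolding eq_edge_marginals_def
proof (intro ballI)
  fix y :: "'v \<times> 'v" and i :: "nat list" and a :: "'a list"
  assume y: "y \<in> parcs X" and i: "i \<in> nlists k {..<2}" and a: "a \<in> nlists k (pverts A)"
  obtain u v where uv: "y = (u, v)" by (cases y)
  let ?S = "scope u \<union> scope v" and ?e = "edge_tuple y"
  let ?Q = "{b \<in> parcs A. proj (edge_tuple b) i = a}"
  have S: "?S = scopes ?e" by (simp add: uv edge_tuple_def)
  have es: "set ?e \<subseteq> pverts X" "length ?e \<le> 2 * k"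
    using y k_pos wf_X pair_wf_digraph.wellformed' by (auto simp: uv edge_tuple_def)
  have isub: "set i \<subseteq> {..<length ?e}" using i by (auto simp: nlists_def edge_tuple_def)
  have fin: "finite ?Q"
    using fin_A by (simp add: pair_fin_digraph.pair_finite_arcs)
  have e: "edge_tuple (col G u, col G v) = map (col G) ?e" for G by (simp add: uv edge_tuple_def)
  have "(\<Sum>b\<in>?Q. mu y b) = expect ?S (\<lambda>G. of_bool ((col G u, col G v) \<in> ?Q))"
    unfolding mu_def uv by (simp add: sum_expect_indicator[OF fin, where f = "\<lambda>G. (col G u, col G v)"])
  also have "\<dots> = expect ?S (\<lambda>G. of_bool (map (col G) (proj ?e i) = a))"
  proof (rule expect_cong)
    show "finite ?S" unfolding S by (rule finite_scopes[OF es(1)])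
    fix G assume "G \<in> ?S \<rightarrow>\<^sub>E L" "inj_on G ?S"
    then have "(col G u, col G v) \<in> parcs A" using y uv by (intro col_arc) auto
    then show "of_bool ((col G u, col G v) \<in> ?Q) = (of_bool (map (col G) (proj ?e i) = a) :: 'r)"
      by (simp add: e proj_map[OF isub])
  qed
  also have "\<dots> = expect (scopes (proj ?e i)) (\<lambda>G. of_bool (map (col G) (proj ?e i) = a))"
  proof (rule expect_mono_scope)
    show "finite ?S" unfolding S by (rule finite_scopes[OF es(1)])
    show "card ?S \<le> K" unfolding S by (rule card_scopes[OF es])
    show "scopes (proj ?e i) \<subseteq> ?S" unfolding S using set_proj[OF isub] by auto
  qed (use map_col_local in metis)
  finally show "(\<Sum>b\<in>?Q. mu y b) = lam (proj ?e i) a" by (simp add: lam_def)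
qed

text \<open>A colour depends on the vertex and not on its position, so equal entries get equal
  colours under each single \<open>G\<close>.\<close>

lemma eq_vertex_prec_lam: "eq_vertex_prec k X A lam"
  unfolding eq_vertex_prec_def
proof (intro ballI impI)
  fix x :: "'v list" and a :: "'a list" assume "\<not> x \<prec>\<^sub>t a"
  then have "map (col G) x \<noteq> a" for G by (auto simp: tuple_prec_def)
  then show "lam x a = 0" by (simp add: lam_def expect_def)
qed

lemma eq_edge_prec_mu: "eq_edge_prec X A mu"
  unfolding eq_edge_prec_def
proof (intro ballI impI)
  fix y :: "'v \<times> 'v" and b :: "'a \<times> 'a" assume *: "\<not> edge_tuple y \<prec>\<^sub>t edge_tuple b"
  have "(col G (fst y), col G (snd y)) \<noteq> b" for G
  proof
    assume "(col G (fst y), col G (snd y)) = b"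
    then have "edge_tuple b = map (col G) (edge_tuple y)" by (auto simp: edge_tuple_def)
    then show False using * by (auto simp: tuple_prec_def)
  qed
  then show "mu y b = 0" by (simp add: mu_def expect_def)
qed

lemma BA_system: "BA_system k X A lam mu"
  by (simp add: BA_system_def eq_sum_one_lam eq_vertex_marginals_lam eq_edge_marginals_lam
      eq_vertex_prec_lam eq_edge_prec_mu)

end

section \<open>Uniform random injections\<close>

text \<open>The product is the reciprocal of the falling factorial that counts injections from
  \<open>S\<close> into \<open>L\<close>.\<close>

definition uniform_inj :: "'l set \<Rightarrow> 's set \<Rightarrow> ('s \<Rightarrow> 'l) \<Rightarrow> rat" where
  "uniform_inj L S G = of_bool (inj_on G S \<and> G ` S \<subseteq> L) * (\<Prod>j<card S. inverse (of_nat (card L - j)))"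

text \<open>An injection on \<open>S - {i}\<close> with \<open>n\<close> points extends in
  \<open>card L - n\<close> ways, and each extension carries the reciprocal of that number as a new
  factor.\<close>

lemma local_measures_uniform_inj:
  assumes L: "finite L" "K \<le> card L"
  shows "local_measures L K (uniform_inj L :: 's set \<Rightarrow> _)"
proof
  fix S :: "'s set" and i G assume S: "finite S" "card S \<le> K" "i \<in> S"
  let ?T = "S - {i}"
  let ?P = "inj_on G ?T \<and> G ` ?T \<subseteq> L"
  define n where "n = card ?T"
  define p where "p = (\<Prod>j<n. inverse (of_nat (card L - j)) :: rat)"
  have n: "card S = Suc n" unfolding n_def using S by (intro card.remove)
  have eq: "uniform_inj L S (G(i := v)) = of_bool ?P * of_bool (v \<notin> G ` ?T) * (p * inverse (of_nat (card L - n)))"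
    if "v \<in> L" for v
  proof -
    have "G(i := v) ` S = insert v (G ` ?T)" using S(3) by auto
    moreover have "inj_on (G(i := v)) S \<longleftrightarrow> inj_on G ?T \<and> v \<notin> G ` ?T"
    proof -
      have "inj_on (G(i := v)) (insert i ?T) \<longleftrightarrow> inj_on (G(i := v)) ?T \<and> v \<notin> (G(i := v)) ` ?T"
        by (subst inj_on_insert) auto
      moreover have "inj_on (G(i := v)) ?T \<longleftrightarrow> inj_on G ?T" by (rule inj_on_cong) auto
      moreover have "(G(i := v)) ` ?T = G ` ?T" by auto
      ultimately show ?thesis using S(3) by (simp add: insert_absorb)
    qed
    ultimately show ?thesis using that by (auto simp: uniform_inj_def n p_def)
  qed
  have "(\<Sum>v\<in>L. uniform_inj L S (G(i := v)))
      = of_bool ?P * (\<Sum>v\<in>L. of_bool (v \<notin> G ` ?T)) * (p * inverse (of_nat (card L - n)))"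
    by (simp add: eq sum_distrib_left sum_distrib_right mult.assoc)
  also have "(\<Sum>v\<in>L. of_bool (v \<notin> G ` ?T)) = (of_nat (card (L - G ` ?T)) :: rat)"
  proof -
    have "L \<inter> {v. v \<notin> G ` ?T} = L - G ` ?T" by blast
    then show ?thesis using L(1) by (simp add: of_bool_def sum.If_cases)
  qed
  also have "of_bool ?P * \<dots> * (p * inverse (of_nat (card L - n))) = of_bool ?P * p"
  proof (cases ?P)
    case True
    then have "card (L - G ` ?T) = card L - n"
      using S(1) by (simp add: card_Diff_subset card_image n_def)
    \<comment> \<open>The new factor inverts a nonzero number because
      \<open>K \<le> card L\<close>.\<close>
    moreover have "n < card L" using n S L by simp
    ultimately show ?thesis by simp
  qed simp
  also have "\<dots> = uniform_inj L ?T G" by (simp add: uniform_inj_def p_def n_def)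
  finally show "(\<Sum>v\<in>L. uniform_inj L S (G(i := v))) = uniform_inj L ?T G" .
qed (auto simp: uniform_inj_def L)

lemma uniform_inj_nonneg: "uniform_inj L S G \<ge> 0"
  by (simp add: uniform_inj_def prod_nonneg)

lemma uniform_inj_pos:
  assumes "inj_on G S" "G ` S \<subseteq> L" "card S \<le> card L"
  shows "uniform_inj L S G > 0"
  using assms by (auto simp: uniform_inj_def intro!: prod_pos)

section \<open>Integral marginals supported on injections\<close>

text \<open>
  The recursion solves \<open>(\<Sum>B \<subseteq> S. (-1) ^ card B * (z\<^sub>B \<otimes> crystal (S - B))) = 0\<close> for its term with
  \<open>B = {}\<close>, where \<open>z\<^sub>B\<close> is the point mass giving each \<open>j \<in> B\<close> the letter \<open>(card S, rank of j in S)\<close>.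
  When a point \<open>i\<close> is summed out, the terms for \<open>B\<close> and \<open>insert i B\<close> cancel, except for \<open>B = {}\<close>.
  The set \<open>B\<close> is read off from the first components of the letters.
\<close>

function crystal :: "'s::linorder set \<Rightarrow> ('s \<Rightarrow> nat \<times> nat) \<Rightarrow> int" where
  "crystal S G =
    (if S = {} \<or> infinite S then 1
     else let B = {j \<in> S. fst (G j) = card S} in
       if B = {} \<or> (\<exists>j\<in>B. snd (G j) \<noteq> card {i \<in> S. i < j}) then 0
       else - ((-1) ^ card B) * crystal (S - B) G)"
  by auto
termination
  by (relation "measure (\<lambda>(S, _). card S)") (auto intro!: psubset_card_mono)

declare crystal.simps [simp del]

lemma crystal_empty [simp]: "crystal {} G = 1"
  by (simp add: crystal.simps)

lemma crystal_nonempty: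
  assumes "finite S" "S \<noteq> {}" "B = {j \<in> S. fst (G j) = card S}"
  shows "crystal S G = (if B = {} \<or> (\<exists>j\<in>B. snd (G j) \<noteq> card {i \<in> S. i < j}) then 0
       else - ((-1) ^ card B) * crystal (S - B) G)"
  using assms by (subst crystal.simps) (auto simp: Let_def)

lemma crystal_local:
  assumes "finite S" "\<And>i. i \<in> S \<Longrightarrow> G i = G' i"
  shows "crystal S G = crystal S G'"
  using assms
proof (induction "card S" arbitrary: S rule: less_induct)
  case less
  show ?case
  proof (cases "S = {}")
    case False
    define B where "B = {j \<in> S. fst (G j) = card S}"
    have B': "B = {j \<in> S. fst (G' j) = card S}" using less.prems by (auto simp: B_def)
    have "crystal (S - B) G = crystal (S - B) G'" if "B \<noteq> {}"
    proof (rule less.hyps)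
      have "S - B \<subset> S" using that by (auto simp: B_def)
      then show "card (S - B) < card S" using less.prems(1) by (rule psubset_card_mono[rotated])
    qed (use less.prems in auto)
    then show ?thesis
      using less.prems
      by (auto simp: crystal_nonempty[OF _ False B_def] crystal_nonempty[OF _ False B'])
        (auto simp: B_def)
  qed simp
qed

text \<open>The recursion peels off blocks whose first components are the sizes of ever smaller
  remaining sets, beginning with \<open>card S\<close>.\<close>

lemma crystal_support:
  assumes "finite S" "crystal S G \<noteq> 0" "j \<in> S"
  shows "fst (G j) \<le> card S"
  using assms
proof (induction "card S" arbitrary: S rule: less_induct)
  case less
  define B where "B = {j \<in> S. fst (G j) = card S}"
  have ne: "S \<noteq> {}" using less.prems by auto
  have B: "B \<noteq> {}" and nz: "crystal (S - B) G \<noteq> 0"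
    using less.prems(2) unfolding crystal_nonempty[OF less.prems(1) ne B_def] by (auto split: if_splits)
  have lt: "card (S - B) < card S"
    using B less.prems by (intro psubset_card_mono) (auto simp: B_def)
  show ?case
  proof (cases "j \<in> B")
    case False
    then have "fst (G j) \<le> card (S - B)" using less.prems lt nz by (intro less.hyps) auto
    then show ?thesis using lt by simp
  qed (simp add: B_def)
qed

text \<open>Different blocks differ in the first component; inside a block the second component is
  the rank in the remaining set.\<close>

lemma crystal_inj:
  assumes "finite S" "crystal S G \<noteq> 0"
  shows "inj_on G S"
  using assms
proof (induction "card S" arbitrary: S rule: less_induct)
  case less
  show ?case
  proof (cases "S = {}")
    case False
    define B where "B = {j \<in> S. fst (G j) = card S}"
    have B: "B \<noteq> {}" and nz: "crystal (S - B) G \<noteq> 0"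
      and rank: "\<And>j. j \<in> B \<Longrightarrow> snd (G j) = card {i \<in> S. i < j}"
      using less.prems(2) unfolding crystal_nonempty[OF less.prems(1) False B_def]
      by (auto split: if_splits)
    have lt: "card (S - B) < card S"
      using B less.prems by (intro psubset_card_mono) (auto simp: B_def)
    have inj1: "inj_on G (S - B)" using less.prems lt nz by (intro less.hyps) auto
    have less_rank: "card {i \<in> S. i < j} < card {i \<in> S. i < j'}" if "j \<in> S" "j < j'" for j j'
      using that less.prems(1) by (intro psubset_card_mono) auto
    have inj2: "inj_on G B"
    proof (rule inj_onI)
      fix j j' assume "j \<in> B" "j' \<in> B" "G j = G j'"
      then have "card {i \<in> S. i < j} = card {i \<in> S. i < j'}" "j \<in> S" "j' \<in> S"
        using rank[of j] rank[of j'] by (simp_all add: B_def)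
      then show "j = j'"
        using less_rank[of j j'] less_rank[of j' j] by (cases j j' rule: linorder_cases) simp_all
    qed
    have "G j \<noteq> G j'" if "j \<in> B" "j' \<in> S - B" for j j'
      using that by (auto simp: B_def)
    then have "inj_on G (B \<union> (S - B))"
      using inj1 inj2 by (subst inj_on_Un) blast
    then show ?thesis by (simp add: B_def Un_absorb1 Collect_subset)
  qed simp
qed

text \<open>Call the first component of a letter its level. Letters of level
  \<open>n = card S\<close> at \<open>i\<close> contribute \<open>q\<close>. If another point has
  level \<open>n\<close>, the remaining letters contribute \<open>- q\<close>; otherwise they
  contribute nothing and \<open>q\<close> is the right-hand side.\<close>

lemma crystal_marginal:
  assumes "finite S" "card S \<le> K" "i \<in> S"
  shows "(\<Sum>v\<in>{1..K} \<times> {..<K}. crystal S (G(i := v))) = crystal (S - {i}) G"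
  using assms
proof (induction "card S" arbitrary: S rule: less_induct)
  case less
  let ?L = "{1..K} \<times> {..<K}"
  define n where "n = card S"
  define C where "C = {j \<in> S - {i}. fst (G j) = n}"
  define rank where "rank j = card {i \<in> S. i < j}" for j
  define ok where "ok \<longleftrightarrow> (\<forall>j\<in>C. snd (G j) = rank j)"
  define q where "q = of_bool ok * (-1) ^ card C * crystal (S - C - {i}) G"
  have ne: "S \<noteq> {}" using less.prems by auto
  have finC: "finite C" and iC: "i \<notin> C" using less.prems by (auto simp: C_def)
  have n: "0 < n" "n \<le> K" using less.prems ne by (auto simp: n_def card_gt_0_iff)
  have "rank i < n"
    unfolding rank_def n_def using less.prems by (intro psubset_card_mono) auto
  \<comment> \<open>The alphabet is made for this: its first factor holds all sizes up to
    \<open>K\<close>, its second all ranks.\<close>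
  then have top_in: "(n, rank i) \<in> ?L" using n by auto
  have top: "crystal S (G(i := v)) = (if v = (n, rank i) then q else 0)" if "fst v = n" for v
  proof -
    let ?G = "G(i := v)"
    have B: "insert i C = {j \<in> S. fst (?G j) = card S}"
      using that less.prems by (auto simp: C_def n_def)
    have bad: "(\<exists>j\<in>insert i C. snd (?G j) \<noteq> card {i \<in> S. i < j}) \<longleftrightarrow> \<not> (snd v = rank i \<and> ok)"
      using iC by (auto simp: ok_def rank_def)
    have "crystal (S - insert i C) ?G = crystal (S - C - {i}) G"
      by (subst Diff_insert, rule crystal_local) (use less.prems in auto)
    \<comment> \<open>\<open>insert i C\<close> has one element more than \<open>C\<close>, which
      absorbs the minus sign of the recursion.\<close>
    then show ?thesis
      unfolding crystal_nonempty[OF less.prems(1) ne B] bad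
      using that finC iC by (cases v) (auto simp: q_def)
  qed
  have rest: "(\<Sum>v\<in>{v\<in>?L. fst v \<noteq> n}. crystal S (G(i := v))) = (if C = {} then 0 else - q)"
  proof -
    have low: "crystal S (G(i := v)) =
        (if C = {} \<or> \<not> ok then 0 else - ((-1) ^ card C) * crystal (S - C) (G(i := v)))"
      if "fst v \<noteq> n" for v
    proof -
      have B: "C = {j \<in> S. fst ((G(i := v)) j) = card S}"
        using that less.prems by (auto simp: C_def n_def)
      have bad: "(\<exists>j\<in>C. snd ((G(i := v)) j) \<noteq> card {i \<in> S. i < j}) \<longleftrightarrow> \<not> ok"
        using iC by (auto simp: ok_def rank_def)
      show ?thesis unfolding crystal_nonempty[OF less.prems(1) ne B] bad by simp
    qed
    show ?thesis
    proof (cases "C = {} \<or> \<not> ok")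
      case True
      then show ?thesis by (auto simp: low q_def)
    next
      case False
      have lt: "card (S - C) < card S"
        using False less.prems by (intro psubset_card_mono) (auto simp: C_def)
      \<comment> \<open>Level \<open>n\<close> exceeds \<open>card (S - C)\<close>, so adding those
        letters changes nothing, and the induction hypothesis applies to the sum over the whole
        alphabet.\<close>
      have zero: "crystal (S - C) (G(i := v)) = 0" if "fst v = n" for v
        using crystal_support[of "S - C" "G(i := v)" i] that less.prems lt iC by (auto simp: n_def)
      have "(\<Sum>v\<in>{v\<in>?L. fst v \<noteq> n}. crystal (S - C) (G(i := v))) = (\<Sum>v\<in>?L. crystal (S - C) (G(i := v)))"
        by (rule sum.mono_neutral_left) (auto simp: zero)
      also have "\<dots> = crystal (S - C - {i}) G"
        using less.prems lt iC by (intro less.hyps) auto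
      moreover have "(\<Sum>v\<in>{v\<in>?L. fst v \<noteq> n}. crystal S (G(i := v)))
          = - ((-1) ^ card C) * (\<Sum>v\<in>{v\<in>?L. fst v \<noteq> n}. crystal (S - C) (G(i := v)))"
        unfolding sum_distrib_left using False by (intro sum.cong) (auto simp: low)
      ultimately show ?thesis
        using False by (simp add: q_def)
    qed
  qed
  have "(\<Sum>v\<in>?L. crystal S (G(i := v)))
      = (\<Sum>v\<in>{v\<in>?L. fst v = n}. crystal S (G(i := v))) + (\<Sum>v\<in>{v\<in>?L. fst v \<noteq> n}. crystal S (G(i := v)))"
    by (subst sum.union_disjoint[symmetric]) (auto intro!: sum.cong)
  also have "(\<Sum>v\<in>{v\<in>?L. fst v = n}. crystal S (G(i := v))) = q"
    using top_in by (simp add: top)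
  also have "q + (\<Sum>v\<in>{v\<in>?L. fst v \<noteq> n}. crystal S (G(i := v))) = (if C = {} then q else 0)"
    unfolding rest by simp
  also have "\<dots> = crystal (S - {i}) G"
  proof (cases "C = {}")
    case False
    \<comment> \<open>Level \<open>n\<close> cannot occur on the \<open>n - 1\<close> points of
      \<open>S - {i}\<close>, so the right-hand side vanishes.\<close>
    then obtain j where "j \<in> S - {i}" "fst (G j) = n" by (auto simp: C_def)
    moreover have "card (S - {i}) < n" unfolding n_def using less.prems by (intro card_Diff1_less)
    ultimately show ?thesis
      using False crystal_support[of "S - {i}" G j] less.prems by force
  qed (simp add: q_def ok_def)
  finally show ?case .
qed

lemma local_measures_crystal:
  "local_measures ({1..K} \<times> {..<K}) K (crystal :: 's::linorder set \<Rightarrow> _)"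
  by standard ((rule crystal_marginal crystal_inj; assumption) | simp)+

section \<open>Combining the rational and the integral solution\<close>

lemma BA_of_local_colouring:
  fixes X :: "'v pair_pre_digraph" and scope :: "'v \<Rightarrow> 's::linorder set"
  assumes "local_colouring ({1..K} \<times> {..<K}) K k X A scope col"
  shows "BA k X A"
proof -
  define L where "L = {1..K} \<times> {..<K}"
  interpret local_colouring L K k X A scope col unfolding L_def by fact
  have KL: "finite L" "K \<le> card L" unfolding L_def by (simp, cases K, auto)
  interpret B: local_measures L K "uniform_inj L :: 's set \<Rightarrow> _"
    using KL by (intro local_measures_uniform_inj) auto
  interpret B: local_solution L K k X A scope col "uniform_inj L" ..
  interpret A: local_measures L K "crystal :: 's set \<Rightarrow> _"
    unfolding L_def by (rule local_measures_crystal)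
  interpret A: local_solution L K k X A scope col crystal ..
  \<comment> \<open>A nonnegative sum vanishes only termwise, so an event of uniform weight zero
    contains no injection into \<open>L\<close>; \<open>crystal\<close> is zero on all other
    maps.\<close>
  have expect_zero: "A.expect S (\<lambda>G. of_bool (P G)) = 0"
    if S: "finite S" "card S \<le> K" and z: "B.expect S (\<lambda>G. of_bool (P G)) = 0" for S P
  proof -
    have fin: "finite (S \<rightarrow>\<^sub>E L)" using S KL by (auto intro!: finite_PiE)
    have nonneg: "0 \<le> uniform_inj L S G * of_bool (P G)" for G
      by (simp add: uniform_inj_nonneg)
    have "crystal S G * of_bool (P G) = 0" if G: "G \<in> S \<rightarrow>\<^sub>E L" for G
    proof (rule ccontr)
      assume "crystal S G * of_bool (P G) \<noteq> 0"
      then have "P G" "inj_on G S" using crystal_inj[OF S(1)] by auto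
      moreover have "uniform_inj L S G > 0"
        using \<open>inj_on G S\<close> by (rule uniform_inj_pos) (use G S KL in \<open>blast, linarith\<close>)
      moreover have "uniform_inj L S G * of_bool (P G) = 0"
        using sum_nonneg_eq_0_iff[THEN iffD1, OF fin nonneg z[unfolded B.expect_def]] G by blast
      ultimately show False by simp
    qed
    then show ?thesis unfolding A.expect_def by (intro sum.neutral ballI)
  qed
  have arc: "finite (scope (fst y) \<union> scope (snd y)) \<and> card (scope (fst y) \<union> scope (snd y)) \<le> K"
    if "y \<in> parcs X" for y
    using that finite_scopes[of "edge_tuple y"] card_scopes[of "edge_tuple y"] k_pos
      pair_wf_digraph.arc_fst_in_verts[OF wf_X that] pair_wf_digraph.arc_snd_in_verts[OF wf_X that]
    by (simp add: edge_tuple_def)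
  have "0 \<le> B.lam x a" for x a
    by (simp add: B.lam_def B.expect_def sum_nonneg uniform_inj_nonneg)
  moreover have "0 \<le> B.mu y b" for y b
    by (simp add: B.mu_def B.expect_def sum_nonneg uniform_inj_nonneg)
  moreover have "A.lam x a = 0" if "x \<in> nlists k (pverts X)" "B.lam x a = 0" for x a
    using that unfolding A.lam_def B.lam_def
    by (intro expect_zero finite_scopes card_scopes) (auto simp: nlists_def)
  moreover have "A.mu y b = 0" if "y \<in> parcs X" "B.mu y b = 0" for y b
    using that arc[of y] unfolding A.mu_def B.mu_def by (intro expect_zero) auto
  ultimately show ?thesis
    unfolding BA_def using A.BA_system B.BA_system by blast
qed

section \<open>Colouring shift digraphs on tuples of letters\<close>

text \<open>Tuples are distinct but need not be increasing, since a random injection may put the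
  letters in any order.\<close>

definition shift_colourable :: "nat \<Rightarrow> 'l set \<Rightarrow> nat \<Rightarrow> bool" where
  "shift_colourable r L N \<longleftrightarrow> (\<exists>h.
     (\<forall>z. length z = r \<longrightarrow> distinct z \<longrightarrow> set z \<subseteq> L \<longrightarrow> h z < N) \<and>
     (\<forall>z. length z = Suc r \<longrightarrow> distinct z \<longrightarrow> set z \<subseteq> L \<longrightarrow> h (butlast z) \<noteq> h (tl z)))"

lemma shift_colourable_1:
  assumes "finite L" "card L \<le> N"
  shows "shift_colourable 1 L N"
proof -
  obtain f where f: "f ` L \<subseteq> {..<N}" "inj_on f L"
    using card_le_inj[of L "{..<N}"] assms by auto
  have "f (hd (butlast z)) \<noteq> f (hd (tl z))"
    if z: "length z = Suc 1" "distinct z" "set z \<subseteq> L" for z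
  proof -
    obtain x y where "z = [x, y]" using z(1) by (auto simp: length_Suc_conv)
    then show ?thesis using z f(2) by (auto simp: inj_on_def)
  qed
  moreover have "f (hd z) < N" if "length z = 1" "set z \<subseteq> L" for z
    using that f(1) by (cases z) auto
  ultimately show ?thesis
    unfolding shift_colourable_def by (intro exI[of _ "f \<circ> hd"]) auto
qed

lemma set_butlast_tl_subset:
  "set z \<subseteq> L \<Longrightarrow> set (butlast z) \<subseteq> L" "set z \<subseteq> L \<Longrightarrow> set (tl z) \<subseteq> L"
  by (auto dest: in_set_butlastD list.set_sel(2)[rotated]) (metis list.sel(2) list.set_sel(2) subsetD)

text \<open>A tuple of length \<open>Suc r\<close> is an arc of the previous digraph; it is coloured
  by an element of \<open>F\<close> at its tail outside \<open>F\<close> at its head. Of two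
  consecutive arcs, the first colour avoids \<open>F\<close> at the common vertex and the second
  lies in it.\<close>

lemma shift_colourable_antichain:
  assumes "shift_colourable r L N"
    and Fc: "\<And>i. i < N \<Longrightarrow> F i \<subseteq> {..<c}"
    and anti: "\<And>i j. \<lbrakk>i < N; j < N; i \<noteq> j\<rbrakk> \<Longrightarrow> \<not> F i \<subseteq> F j"
  shows "shift_colourable (Suc r) L c"
proof -
  obtain h where h: "\<And>z. \<lbrakk>length z = r; distinct z; set z \<subseteq> L\<rbrakk> \<Longrightarrow> h z < N"
    and hne: "\<And>z. \<lbrakk>length z = Suc r; distinct z; set z \<subseteq> L\<rbrakk> \<Longrightarrow> h (butlast z) \<noteq> h (tl z)"
    using assms(1) by (auto simp: shift_colourable_def)
  define g where "g z = (SOME e. e \<in> F (h (butlast z)) - F (h (tl z)))" for z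
  have g: "g z \<in> F (h (butlast z)) - F (h (tl z))"
    and gc: "g z < c" if z: "length z = Suc r" "distinct z" "set z \<subseteq> L" for z
  proof -
    have lt: "h (butlast z) < N" "h (tl z) < N"
      using z set_butlast_tl_subset[OF z(3)] by (auto intro!: h simp: distinct_butlast distinct_tl)
    then have "\<exists>e. e \<in> F (h (butlast z)) - F (h (tl z))" using anti hne[OF z] by blast
    then show "g z \<in> F (h (butlast z)) - F (h (tl z))" unfolding g_def by (rule someI_ex)
    then show "g z < c" using Fc lt by blast
  qed
  have "g (butlast z) \<noteq> g (tl z)" if z: "length z = Suc (Suc r)" "distinct z" "set z \<subseteq> L" for z
  proof -
    have "g (butlast z) \<notin> F (h (tl (butlast z)))"
      using g[of "butlast z"] z by (simp add: distinct_butlast set_butlast_tl_subset)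
    moreover have "g (tl z) \<in> F (h (butlast (tl z)))"
      using g[of "tl z"] z by (simp add: distinct_tl set_butlast_tl_subset)
    ultimately show ?thesis by (metis butlast_tl)
  qed
  then show ?thesis
    unfolding shift_colourable_def using gc by blast
qed

text \<open>The antichain is given by the graphs of the binary digit functions of the numbers below \<open>2 ^ t\<close>.\<close>

lemma shift_colourable_log:
  assumes "shift_colourable r L (2 ^ t)"
  shows "shift_colourable (Suc r) L (2 * t)"
proof (rule shift_colourable_antichain[OF assms])
  let ?F = "\<lambda>i::nat. (\<lambda>b. 2 * b + of_bool (bit i b)) ` {..<t}"
  show "?F i \<subseteq> {..<2 * t}" for i by (auto simp: of_bool_def)
  fix i j :: nat assume ij: "i < 2 ^ t" "j < 2 ^ t" "i \<noteq> j"
  obtain b where b: "bit i b \<noteq> bit j b" using ij(3) bit_eq_iff by blast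
  have "take_bit t i = i" "take_bit t j = j" using ij by (auto simp: take_bit_nat_eq_self_iff)
  then have "b < t" using b by (metis bit_take_bit_iff)
  moreover have "2 * b + of_bool (bit i b) \<noteq> 2 * b' + of_bool (bit j b')" for b'
    using b by (cases "bit i b"; cases "bit j b'"; auto; presburger)
  ultimately show "\<not> ?F i \<subseteq> ?F j" by blast
qed

text \<open>At six colours \<open>shift_colourable_log\<close> stalls, as \<open>t = 3\<close>
  returns six. The six pairs in a four-element set form a better antichain.\<close>

lemma shift_colourable_6_4:
  assumes "shift_colourable r L 6"
  shows "shift_colourable (Suc r) L 4"
proof (rule shift_colourable_antichain[OF assms])
  let ?F = "\<lambda>i::nat. [{0,1}, {0,2}, {0,3}, {1,2}, {1,3}, {2,3::nat}] ! i"
  have "\<forall>i\<in>{..<6}. ?F i \<subseteq> {..<4}" by code_simp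
  then show "?F i \<subseteq> {..<4}" if "i < 6" for i using that by blast
  have "\<forall>i\<in>{..<6}. \<forall>j\<in>{..<6}. i \<noteq> j \<longrightarrow> \<not> ?F i \<subseteq> ?F j" by code_simp
  then show "\<not> ?F i \<subseteq> ?F j" if "i < 6" "j < 6" "i \<noteq> j" for i j using that by blast
qed

text \<open>Subsets of a three-element set have no antichain of size four, so two shift steps are
  taken at once: the first colours by sets \<open>T i j\<close>, the second by an element of the
  difference of two such sets.\<close>

lemma shift_colourable_4_3:
  assumes "shift_colourable r L 4"
  shows "shift_colourable (Suc (Suc r)) L 3"
proof -
  obtain h where h: "\<And>z. \<lbrakk>length z = r; distinct z; set z \<subseteq> L\<rbrakk> \<Longrightarrow> h z < (4::nat)"
    and hne: "\<And>z. \<lbrakk>length z = Suc r; distinct z; set z \<subseteq> L\<rbrakk> \<Longrightarrow> h (butlast z) \<noteq> h (tl z)"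
    using assms by (auto simp: shift_colourable_def)
  \<comment> \<open>\<open>T i j\<close> is chosen in \<open>D i - D j\<close> for an antichain of four down-sets \<open>D i\<close> of subsets of
    \<open>{0, 1, 2}\<close>: the sets with at most one element, and the three power sets of pairs.\<close>
  define T :: "nat \<Rightarrow> nat \<Rightarrow> nat set"
    where "T i j = (if i = 0 then [{}, {0}, {1}, {2}] ! j else [{}, {1,2}, {0,2}, {0,1}] ! i)" for i j
  \<comment> \<open>\<open>T j l\<close> lies in the down-set \<open>D j\<close> and
    \<open>T i j\<close> does not, which excludes inclusion.\<close>
  have anti: "\<not> T i j \<subseteq> T j l" if "i < 4" "j < 4" "l < 4" "i \<noteq> j" "j \<noteq> l" for i j l
  proof -
    have "i = 0 \<or> i = 1 \<or> i = 2 \<or> i = 3" "j = 0 \<or> j = 1 \<or> j = 2 \<or> j = 3"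
      "l = 0 \<or> l = 1 \<or> l = 2 \<or> l = 3"
      using that by linarith+
    then show ?thesis using that(4,5) by (elim disjE) (simp_all add: T_def)
  qed
  have T3: "T i j \<subseteq> {..<3}" if "i < 4" "j < 4" for i j
  proof -
    have "i = 0 \<or> i = 1 \<or> i = 2 \<or> i = 3" "j = 0 \<or> j = 1 \<or> j = 2 \<or> j = 3"
      using that by linarith+
    then show ?thesis by (elim disjE) (simp_all add: T_def)
  qed
  define g where "g z = (SOME e. e \<in> T (h (butlast (butlast z))) (h (butlast (tl z)))
     - T (h (butlast (tl z))) (h (tl (tl z))))" for z
  have g: "g z \<in> T (h (butlast (butlast z))) (h (butlast (tl z)))
     - T (h (butlast (tl z))) (h (tl (tl z)))"
    and g3: "g z < 3" if z: "length z = Suc (Suc r)" "distinct z" "set z \<subseteq> L" for z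
  proof -
    have lt: "h (butlast (butlast z)) < 4" "h (butlast (tl z)) < 4" "h (tl (tl z)) < 4"
      using z set_butlast_tl_subset[OF set_butlast_tl_subset(1)[OF z(3)]]
        set_butlast_tl_subset[OF set_butlast_tl_subset(2)[OF z(3)]]
      by (auto intro!: h simp: distinct_butlast distinct_tl)
    have ne: "h (butlast (butlast z)) \<noteq> h (butlast (tl z))" "h (butlast (tl z)) \<noteq> h (tl (tl z))"
      using hne[of "butlast z"] hne[of "tl z"] z
      by (auto simp: distinct_butlast distinct_tl set_butlast_tl_subset butlast_tl)
    show "g z \<in> T (h (butlast (butlast z))) (h (butlast (tl z)))
     - T (h (butlast (tl z))) (h (tl (tl z)))"
      unfolding g_def by (rule someI_ex) (use anti[OF lt ne] in blast)
    then show "g z < 3" using T3[OF lt(1,2)] by blast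
  qed
  have "g (butlast z) \<noteq> g (tl z)" if z: "length z = Suc (Suc (Suc r))" "distinct z" "set z \<subseteq> L" for z
  proof -
    have "g (butlast z) \<notin> T (h (butlast (tl (butlast z)))) (h (tl (tl (butlast z))))"
      using g[of "butlast z"] z by (simp add: distinct_butlast set_butlast_tl_subset)
    moreover have "g (tl z) \<in> T (h (butlast (butlast (tl z)))) (h (butlast (tl (tl z))))"
      using g[of "tl z"] z by (simp add: distinct_tl set_butlast_tl_subset)
    ultimately show ?thesis by (metis butlast_tl)
  qed
  then show ?thesis
    unfolding shift_colourable_def using g3 by blast
qed

section \<open>Choice of the parameters\<close>

text \<open>The recursion inverts \<open>shift_colourable_log\<close>, with the halving rounded
  down; it starts at the six colours of \<open>shift_colourable_6_4\<close>.\<close>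

fun tower :: "nat \<Rightarrow> nat" where
  "tower 0 = 6"
| "tower (Suc j) = 2 ^ (tower j div 2)"

text \<open>This weak bound suffices, as one more exponentiation gives
  \<open>2 ^ j \<le> tower (Suc j)\<close>.\<close>

lemma tower_ge: "2 * j + 6 \<le> tower j"
proof (induction j)
  case (Suc j)
  have "2 * Suc j + 6 \<le> 2 ^ (j + 3)" by (induction j) (auto simp: power_add)
  also have "\<dots> \<le> 2 ^ (tower j div 2)" using Suc by (intro power_increasing) auto
  finally show ?case by simp
qed simp

lemma shift_colourable_mono: "shift_colourable r L M \<Longrightarrow> M \<le> N \<Longrightarrow> shift_colourable r L N"
  unfolding shift_colourable_def by (meson order_less_le_trans)

lemma shift_colourable_tower:
  "shift_colourable r L (tower j) \<Longrightarrow> shift_colourable (r + j) L 6"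
proof (induction j arbitrary: r)
  case (Suc j)
  have "shift_colourable (Suc r) L (2 * (tower j div 2))"
    using Suc.prems by (intro shift_colourable_log) simp
  then have "shift_colourable (Suc r) L (tower j)"
    by (rule shift_colourable_mono) simp
  then show ?case using Suc.IH[of "Suc r"] by simp
qed simp

text \<open>The alphabet has \<open>K * K\<close> letters and itself grows with \<open>r\<close>,
  but only quadratically.\<close>

lemma exists_shift_colourable:
  obtains r K where "r \<ge> 1" "K = 2 * k * r" "shift_colourable r ({1..K} \<times> {..<K}) 3"
proof -
  \<comment> \<open>Chosen so that both \<open>2 * k\<close> and \<open>j + 5\<close> are at most
    \<open>2 ^ (k + 5)\<close>, whose fourth power is \<open>2 ^ j\<close>.\<close>
  define j where "j = 4 * (k + 5)"
  have pow: "(2::nat) ^ (k + 5) = 32 * 2 ^ k" by (simp add: power_add)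
  have "Suc k \<le> 2 ^ k" by (rule Suc_leI[OF less_exp])
  then have "2 * k \<le> 2 ^ (k + 5) \<and> j + 5 \<le> 2 ^ (k + 5)"
    unfolding pow j_def by simp
  then have "2 * k * (j + 5) \<le> 2 ^ (k + 5) * 2 ^ (k + 5)" by (intro mult_mono) auto
  then have "(2 * k * (j + 5))\<^sup>2 \<le> (2 ^ (k + 5) * 2 ^ (k + 5))\<^sup>2" by (rule power_mono) simp
  also have "\<dots> = 2 ^ j" by (simp add: j_def flip: power_add power_mult)
  finally have j: "(2 * k * (j + 5))\<^sup>2 \<le> 2 ^ j" .
  \<comment> \<open>Level 1, then \<open>Suc j\<close> logarithmic steps, one from six to four
    colours and two from four to three.\<close>
  define r where "r = j + 5"
  define K where "K = 2 * k * r"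
  have "card ({1..K} \<times> {..<K}) = K\<^sup>2" by (simp add: power2_eq_square)
  also have "\<dots> \<le> 2 ^ j" using j by (simp add: K_def r_def)
  also have "\<dots> \<le> tower (Suc j)"
    using tower_ge[of j] by (auto intro!: power_increasing)
  finally have "shift_colourable 1 ({1..K} \<times> {..<K}) (tower (Suc j))"
    by (intro shift_colourable_1) auto
  then have "shift_colourable (1 + Suc j) ({1..K} \<times> {..<K}) 6"
    by (rule shift_colourable_tower)
  then have "shift_colourable r ({1..K} \<times> {..<K}) 3"
    using shift_colourable_4_3[OF shift_colourable_6_4] by (fastforce simp: r_def eval_nat_numeral)
  moreover have "1 \<le> r" by (simp add: r_def)
  ultimately show thesis using that K_def by blast
qed

section \<open>The shift digraph on subsets and its chromatic number\<close>

text \<open>Subsets are coded by \<open>set_encode\<close> because instances have natural numbers as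
  vertices.\<close>

definition shift_digraph :: "nat \<Rightarrow> nat \<Rightarrow> nat pair_pre_digraph" where
  "shift_digraph r n =
    \<lparr>pverts = set_encode ` nsets {..<n} r,
     parcs = (\<lambda>z. (set_encode (set (butlast z)), set_encode (set (tl z)))) `
       {z. sorted_wrt (<) z \<and> length z = Suc r \<and> set z \<subseteq> {..<n}}\<rparr>"

lemma strict_sorted_butlast_tl:
  fixes z :: "'a::linorder list"
  assumes "sorted_wrt (<) z"
  shows "sorted_list_of_set (set (butlast z)) = butlast z" "sorted_list_of_set (set (tl z)) = tl z"
    "card (set (butlast z)) = length z - 1" "card (set (tl z)) = length z - 1"
proof -
  have z: "distinct z" "sorted z" using assms by (auto simp: strict_sorted_iff)
  show "sorted_list_of_set (set (butlast z)) = butlast z"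
    by (rule sorted_list_of_set.idem_if_sorted_distinct) (use z in \<open>auto simp: sorted_butlast distinct_butlast\<close>)
  show "sorted_list_of_set (set (tl z)) = tl z"
    by (rule sorted_list_of_set.idem_if_sorted_distinct) (use z in \<open>auto simp: sorted_tl distinct_tl\<close>)
  show "card (set (butlast z)) = length z - 1" "card (set (tl z)) = length z - 1"
    using z by (auto simp: distinct_card distinct_butlast distinct_tl)
qed

lemma pair_fin_digraph_shift: "pair_fin_digraph (shift_digraph r n)"
proof
  let ?Z = "{z. sorted_wrt (<) z \<and> length z = Suc r \<and> set z \<subseteq> {..<n}}"
  have "?Z \<subseteq> {z. set z \<subseteq> {..<n} \<and> length z = Suc r}" by auto
  then have "finite ?Z" by (rule finite_subset) (simp add: finite_lists_length_eq)
  then show "finite (parcs (shift_digraph r n))" by (simp add: shift_digraph_def)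
  show "finite (pverts (shift_digraph r n))"
    by (simp add: shift_digraph_def finite_imp_finite_nsets)
  have "set (butlast z) \<in> nsets {..<n} r \<and> set (tl z) \<in> nsets {..<n} r" if "z \<in> ?Z" for z
    using that strict_sorted_butlast_tl[of z] set_butlast_tl_subset[of z "{..<n}"] by (auto simp: nsets_def)
  then show "fst e \<in> pverts (shift_digraph r n)" "snd e \<in> pverts (shift_digraph r n)"
    if "e \<in> parcs (shift_digraph r n)" for e
    using that by (auto simp: shift_digraph_def)
qed

text \<open>Ramsey's theorem for \<open>r\<close>-subsets gives a monochromatic set of
  \<open>Suc r\<close> points; listed in increasing order it is an arc whose ends share a
  colour.\<close>

lemma shift_digraph_not_colourable:
  obtains n where "\<not> hom_exists (shift_digraph r n) (complete_digraph_on d)"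
proof -
  obtain n :: nat where n: "partn_lst {..<n} (replicate d (Suc r)) r"
    using ramsey_full by blast
  have "\<not> digraph_hom (shift_digraph r n) (complete_digraph_on d) f" for f
  proof
    assume f: "digraph_hom (shift_digraph r n) (complete_digraph_on d) f"
    have "f (set_encode Y) \<in> {1..d}" if "Y \<in> nsets {..<n} r" for Y
      using f that by (auto simp: digraph_hom_def shift_digraph_def complete_digraph_on_def)
    \<comment> \<open>Colours start at 1, so the truncated subtraction moves them into
      \<open>{..<d}\<close> without identifying any two.\<close>
    then have "(\<lambda>Y. f (set_encode Y) - 1) \<in> nsets {..<n} r \<rightarrow> {..<d}" by fastforce
    then obtain i where "i < d"
      and "monochromatic {..<n} (replicate d (Suc r) ! i) r (\<lambda>Y. f (set_encode Y) - 1) i"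
      using n unfolding partn_lst_def length_replicate by blast
    then obtain H where H: "H \<in> nsets {..<n} (Suc r)"
      and mono: "(\<lambda>Y. f (set_encode Y) - 1) ` nsets H r \<subseteq> {i}"
      by (auto simp: monochromatic_def)
    define z where "z = sorted_list_of_set H"
    have z: "sorted_wrt (<) z" "length z = Suc r" "set z = H"
      using H by (auto simp: z_def nsets_def)
    have arc: "(set_encode (set (butlast z)), set_encode (set (tl z))) \<in> parcs (shift_digraph r n)"
      using z H by (auto simp: shift_digraph_def nsets_def)
    then have "(f (set_encode (set (butlast z))), f (set_encode (set (tl z)))) \<in> parcs (complete_digraph_on d)"
      using f by (auto simp: digraph_hom_def)
    then have ne: "f (set_encode (set (butlast z))) - 1 \<noteq> f (set_encode (set (tl z))) - 1"
      by (auto simp: complete_digraph_on_def)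
    have "set (butlast z) \<in> nsets H r" "set (tl z) \<in> nsets H r"
      using strict_sorted_butlast_tl[OF z(1)] set_butlast_tl_subset[of z H] z by (auto simp: nsets_def)
    then show False using mono ne by blast
  qed
  then show thesis using that by (auto simp: hom_exists_def)
qed

section \<open>The system on the shift digraph is solvable\<close>

lemma pair_fin_digraph_complete: "pair_fin_digraph (complete_digraph_on c)"
proof
  have "parcs (complete_digraph_on c) \<subseteq> {1..c} \<times> {1..c}" by (auto simp: complete_digraph_on_def)
  then show "finite (parcs (complete_digraph_on c))" by (rule finite_subset) simp
qed (auto simp: complete_digraph_on_def)

lemma BA_shift_digraph:
  assumes "k \<ge> 1" "r \<ge> 1" "K = 2 * k * r" "shift_colourable r ({1..K} \<times> {..<K}) 3" "3 \<le> c"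
  shows "BA k (shift_digraph r n) (complete_digraph_on c)"
proof -
  let ?L = "{1..K} \<times> {..<K}"
  obtain h where h: "\<And>z. \<lbrakk>length z = r; distinct z; set z \<subseteq> ?L\<rbrakk> \<Longrightarrow> h z < (3::nat)"
    and hne: "\<And>z. \<lbrakk>length z = Suc r; distinct z; set z \<subseteq> ?L\<rbrakk> \<Longrightarrow> h (butlast z) \<noteq> h (tl z)"
    using assms(4) by (auto simp: shift_colourable_def)
  \<comment> \<open>The letters are read in increasing order of the points; \<open>Suc\<close>
    matches the vertex set \<open>{1..c}\<close>.\<close>
  define col where "col G v = Suc (h (map G (sorted_list_of_set (set_decode v))))" for G :: "nat \<Rightarrow> nat \<times> nat" and v
  have col_vert: "col G v \<in> pverts (complete_digraph_on c)"
    if "v \<in> pverts (shift_digraph r n)" "G ` set_decode v \<subseteq> ?L" "inj_on G (set_decode v)" for G v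
  proof -
    have "card (set_decode v) = r" using that(1) by (auto simp: shift_digraph_def nsets_def)
    then have "h (map G (sorted_list_of_set (set_decode v))) < 3"
      using that by (intro h) (auto simp: distinct_map)
    then show ?thesis using assms(5) by (auto simp: col_def complete_digraph_on_def)
  qed
  interpret S: pair_fin_digraph "shift_digraph r n" by (rule pair_fin_digraph_shift)
  have "local_colouring ?L K k (shift_digraph r n) (complete_digraph_on c) set_decode col"
  proof (rule local_colouring.intro)
    show "1 \<le> k" by fact
    show "pair_wf_digraph (shift_digraph r n)" by unfold_locales
    show "pair_fin_digraph (complete_digraph_on c)" by (rule pair_fin_digraph_complete)
    fix v assume v: "v \<in> pverts (shift_digraph r n)"
    show "finite (set_decode v)" by simp
    have "card (set_decode v) = r" using v by (auto simp: shift_digraph_def nsets_def)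
    then show "2 * k * card (set_decode v) \<le> K" using assms(3) by simp
  next
    fix v and G G' :: "nat \<Rightarrow> nat \<times> nat" assume "\<And>i. i \<in> set_decode v \<Longrightarrow> G i = G' i"
    then have "map G (sorted_list_of_set (set_decode v)) = map G' (sorted_list_of_set (set_decode v))" by simp
    then show "col G v = col G' v" by (simp only: col_def)
  next
    fix u v G assume uv: "(u, v) \<in> parcs (shift_digraph r n)"
      and GL: "G ` (set_decode u \<union> set_decode v) \<subseteq> ?L" and inj: "inj_on G (set_decode u \<union> set_decode v)"
    obtain z where z: "sorted_wrt (<) z" "length z = Suc r"
      and u: "set_decode u = set (butlast z)" and v: "set_decode v = set (tl z)"
      using uv by (auto simp: shift_digraph_def)
    \<comment> \<open>This uses \<open>r \<ge> 1\<close>: for a single-entry list both parts would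
      be empty. Injectivity on the two scopes thus gives distinct letters along all of
      \<open>z\<close>.\<close>
    have "set z = set (butlast z) \<union> set (tl z)"
    proof (cases z)
      case (Cons x xs)
      then have "xs \<noteq> []" using z(2) assms(2) by auto
      then show ?thesis using Cons by (auto dest: in_set_butlastD)
    qed simp
    then have "set (map G z) \<subseteq> ?L" "inj_on G (set z)" using GL inj u v by auto
    then have "h (butlast (map G z)) \<noteq> h (tl (map G z))"
      using z by (intro hne) (auto simp: distinct_map strict_sorted_iff)
    \<comment> \<open>Sorting the two ends gives back \<open>butlast z\<close> and
      \<open>tl z\<close>, so \<open>G\<close> carries the arc to an arc between tuples of
      letters.\<close>
    then have "col G u \<noteq> col G v"
      using strict_sorted_butlast_tl(1,2)[OF z(1)] by (simp add: col_def u v map_butlast map_tl)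
    moreover have "col G u \<in> pverts (complete_digraph_on c)" "col G v \<in> pverts (complete_digraph_on c)"
      using S.in_arcsD1[OF uv] S.in_arcsD2[OF uv] GL inj by (auto intro!: col_vert intro: inj_on_subset)
    ultimately show "(col G u, col G v) \<in> parcs (complete_digraph_on c)"
      by (auto simp: complete_digraph_on_def)
  qed (fact col_vert)
  then show ?thesis by (rule BA_of_local_colouring)
qed

theorem theorem2p1:
  fixes c d :: nat
  assumes "3 \<le> c" and "c \<le> d"
  shows "\<not> (\<exists>k\<ge>1. BA_solves_PCSP k (complete_digraph_on c) (complete_digraph_on d))"
proof clarify
  fix k :: nat
  assume k: "1 \<le> k" and solves: "BA_solves_PCSP k (complete_digraph_on c) (complete_digraph_on d)"
  obtain r K where rK: "1 \<le> r" "K = 2 * k * r" "shift_colourable r ({1..K} \<times> {..<K}) 3"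
    by (rule exists_shift_colourable)
  obtain n where "\<not> hom_exists (shift_digraph r n) (complete_digraph_on d)"
    by (rule shift_digraph_not_colourable)
  moreover have "BA k (shift_digraph r n) (complete_digraph_on c)"
    using k rK assms(1) by (intro BA_shift_digraph)
  ultimately show False
    using solves pair_fin_digraph_shift unfolding BA_solves_PCSP_def by blast
qed

end
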